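(* Let $G$ be a finite connected graph and let $R$ be a USP-relation on $E(G)$. Then the partition $\mathcal P^R=\{V_R(x)\mid x\in V(G)\}$ of $V(G)$, where $V_R(x)=\bigcap_{\varphi} V(G^x_{\overline\varphi})$ with the intersection over all $R$-classes $\varphi$, is an equitable partition of $G$.
   Context: $G$ is a finite connected simple graph. For a set $\varphi\subseteq E(G)$, $G_\varphi$ denotes the spanning subgraph with vertex set $V(G)$ and edge set $\varphi$, $G_\varphi^x$ denotes the connected component of $G_\varphi$ containing the vertex $x$, and $\overline\varphi=E(G)\setminus\varphi$. A chordless square is an induced cycle on four vertices. An equivalence relation $Q$ on $E(G)$ has the unique square property if any two adjacent edges $e,f$ lying in distinct $Q$-classes are contained in exactly one chordless square whose opposite edges lie in the same $Q$-class. An equivalence relation $R$ on $E(G)$ is a USP-relation if there exists an equivalence relation $Q\subseteq R$ (i.e. $Q$ is finer than $R$) with the unique square property. A partition $\mathcal P$ of $V(G)$ is equitable if for all (not necessarily distinct) classes $A,B\in\mathcal P$, every vertex $x\in A$ has the same number $|N_G(x)\cap B|$ of neighbours in $B$. *)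

theory Defs
  imports Main "HOL-Library.Disjoint_Sets"
begin

text \<open>A simple graph is given by its vertex set \<open>V\<close> and its edge set \<open>E\<close>, where an edge is the
  two-element set of its end vertices.\<close>

definition simple_graph :: "'a set \<Rightarrow> 'a set set \<Rightarrow> bool" where
  "simple_graph V E \<longleftrightarrow> (\<forall>e\<in>E. e \<subseteq> V \<and> card e = 2)"

definition neighbours :: "'a set set \<Rightarrow> 'a \<Rightarrow> 'a set" where
  "neighbours E x = {y. {x, y} \<in> E}"

definition component :: "'a set \<Rightarrow> 'a set set \<Rightarrow> 'a \<Rightarrow> 'a set" where
  "component V F x = {y \<in> V. (x, y) \<in> {(u, v). {u, v} \<in> F}\<^sup>*}"

definition connected_graph :: "'a set \<Rightarrow> 'a set set \<Rightarrow> bool" where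
  "connected_graph V E \<longleftrightarrow> V \<noteq> {} \<and> (\<forall>x\<in>V. component V E x = V)"

text \<open>An induced subgraph is determined by its vertex set, so a chordless square is represented by
  the set \<open>S\<close> of its four vertices; it contains the edge \<open>e\<close> iff \<open>e \<subseteq> S\<close>.\<close>

definition chordless_square :: "'a set set \<Rightarrow> 'a set \<Rightarrow> bool" where
  "chordless_square E S \<longleftrightarrow>
     (\<exists>a b c d. distinct [a, b, c, d] \<and> S = {a, b, c, d} \<and>
        {a, b} \<in> E \<and> {b, c} \<in> E \<and> {c, d} \<in> E \<and> {d, a} \<in> E \<and>
        {a, c} \<notin> E \<and> {b, d} \<notin> E)"

text \<open>Two edges of a square are opposite iff they are disjoint.\<close>

definition opposite_edges_related :: "'a set set \<Rightarrow> 'a set rel \<Rightarrow> 'a set \<Rightarrow> bool" where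
  "opposite_edges_related E Q S \<longleftrightarrow>
     (\<forall>g\<in>E. \<forall>h\<in>E. g \<subseteq> S \<and> h \<subseteq> S \<and> g \<inter> h = {} \<longrightarrow> (g, h) \<in> Q)"

definition adjacent_edges :: "'a set \<Rightarrow> 'a set \<Rightarrow> bool" where
  "adjacent_edges e f \<longleftrightarrow> e \<noteq> f \<and> e \<inter> f \<noteq> {}"

text \<open>Uniqueness is among the chordless squares with opposite edges in the same class; other
  chordless squares containing \<open>e\<close> and \<open>f\<close> are not excluded.\<close>

definition unique_square_property :: "'a set set \<Rightarrow> 'a set rel \<Rightarrow> bool" where
  "unique_square_property E Q \<longleftrightarrow>
     (\<forall>e\<in>E. \<forall>f\<in>E. adjacent_edges e f \<and> (e, f) \<notin> Q \<longrightarrow>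
        (\<exists>!S. chordless_square E S \<and> e \<subseteq> S \<and> f \<subseteq> S \<and> opposite_edges_related E Q S))"

definition USP_relation :: "'a set set \<Rightarrow> 'a set rel \<Rightarrow> bool" where
  "USP_relation E R \<longleftrightarrow>
     equiv E R \<and> (\<exists>Q. equiv E Q \<and> Q \<subseteq> R \<and> unique_square_property E Q)"

text \<open>The intersection is taken inside \<open>V\<close>: if \<open>E\<close> is empty there are no classes and it is \<open>V\<close>.\<close>

definition V_class :: "'a set \<Rightarrow> 'a set set \<Rightarrow> 'a set rel \<Rightarrow> 'a \<Rightarrow> 'a set" where
  "V_class V E R x = V \<inter> (\<Inter>\<phi>\<in>E // R. component V (E - \<phi>) x)"

definition vertex_partition :: "'a set \<Rightarrow> 'a set set \<Rightarrow> 'a set rel \<Rightarrow> 'a set set" where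
  "vertex_partition V E R = {V_class V E R x | x. x \<in> V}"

definition equitable_partition :: "'a set \<Rightarrow> 'a set set \<Rightarrow> 'a set set \<Rightarrow> bool" where
  "equitable_partition V E P \<longleftrightarrow>
     partition_on V P \<and>
     (\<forall>A\<in>P. \<forall>B\<in>P. \<forall>x\<in>A. \<forall>y\<in>A. card (neighbours E x \<inter> B) = card (neighbours E y \<inter> B))"

end

theory Submission
  imports Defs
begin

text \<open>Let \<open>x\<close> and \<open>x'\<close> be joined by an edge outside the \<open>R\<close>-class \<open>\<phi>\<close>. Completing the edges \<open>xz \<in> \<phi>\<close>
  and \<open>xx'\<close> to their unique square \<open>x, z, w, x'\<close> gives an injection \<open>z \<mapsto> w\<close> from the
  \<open>\<phi>\<close>-neighbours of \<open>x\<close> to those of \<open>x'\<close>; as \<open>zw\<close> is equivalent to \<open>xx'\<close>, it preserves the components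
  of the graph without \<open>\<phi>\<close>. Hence the number of \<open>\<phi>\<close>-neighbours of \<open>x\<close> inside a fixed such component
  is constant along paths avoiding \<open>\<phi>\<close>. A \<open>\<phi>\<close>-edge does not leave the components belonging to
  the other classes, so the \<open>\<phi>\<close>-neighbours of \<open>x\<close> in a class \<open>B\<close> of the partition are either all
  the \<open>\<phi>\<close>-neighbours in the component of \<open>B\<close> or none, depending only on the class of \<open>x\<close>.\<close>

lemma component_self: "x \<in> V \<Longrightarrow> x \<in> component V F x"
  by (simp add: component_def)

lemma component_eq:
  assumes "y \<in> component V F x"
  shows "component V F y = component V F x"
proof -
  let ?r = "{(u, v). {u, v} \<in> F}"
  have "sym ?r" by (auto simp: sym_def insert_commute)
  then have "sym (?r\<^sup>*)" by (rule sym_rtrancl)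
  moreover have "(x, y) \<in> ?r\<^sup>*" using assms by (simp add: component_def)
  ultimately show ?thesis
    unfolding component_def by (auto dest: symD intro: rtrancl_trans)
qed

lemma component_edge:
  assumes "{x, y} \<in> F" "y \<in> V"
  shows "component V F y = component V F x"
  by (rule component_eq) (use assms in \<open>auto simp: component_def\<close>)

lemma component_eq_iff:
  "y \<in> component V F x \<longleftrightarrow> y \<in> V \<and> component V F y = component V F x"
proof
  assume "y \<in> component V F x"
  then show "y \<in> V \<and> component V F y = component V F x"
    using component_eq[of y V F x] by (simp add: component_def)
next
  assume "y \<in> V \<and> component V F y = component V F x"
  then show "y \<in> component V F x" using component_self by metis
qed

text \<open>Stated as equality of components for every class, membership is visibly an equivalence
  relation between vertices; this is what makes the sets a partition.\<close>

lemma V_class_iff: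
  "y \<in> V_class V E R x \<longleftrightarrow>
    y \<in> V \<and> (\<forall>\<phi>\<in>E // R. component V (E - \<phi>) y = component V (E - \<phi>) x)"
  by (auto simp: V_class_def component_eq_iff)

lemma V_class_eq: "y \<in> V_class V E R x \<Longrightarrow> V_class V E R y = V_class V E R x"
  by (auto simp: V_class_iff)

lemma partition_on_vertex_partition: "partition_on V (vertex_partition V E R)"
proof (rule partition_onI)
  have self: "x \<in> V_class V E R x" if "x \<in> V" for x
    using that by (simp add: V_class_iff)
  show "{} \<notin> vertex_partition V E R"
    using self by (fastforce simp: vertex_partition_def)
  show "\<Union> (vertex_partition V E R) = V"
    using self by (auto simp: vertex_partition_def V_class_iff)
  show "disjnt p q"
    if "p \<in> vertex_partition V E R" "q \<in> vertex_partition V E R" "p \<noteq> q" for p q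
  proof -
    obtain x y where "p = V_class V E R x" "q = V_class V E R y"
      using \<open>p \<in> _\<close> \<open>q \<in> _\<close> by (auto simp: vertex_partition_def)
    then show ?thesis
      using \<open>p \<noteq> q\<close> V_class_eq unfolding disjnt_iff by metis
  qed
qed

lemma simple_graph_edgeD:
  assumes "simple_graph V E" "{x, y} \<in> E"
  shows "x \<in> V" "y \<in> V" "x \<noteq> y"
  using assms unfolding simple_graph_def by fastforce+

lemma finite_edges:
  assumes "finite V" "simple_graph V E"
  shows "finite E"
  by (rule finite_subset[of _ "Pow V"]) (use assms in \<open>auto simp: simple_graph_def\<close>)

text \<open>Since the square has no chords, the neighbours of \<open>x\<close> in it are exactly the
  two vertices next to it on the cycle; the remaining vertex is opposite \<open>x\<close> and
  adjacent to both.\<close>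

lemma chordless_square_fourth_vertex:
  assumes "chordless_square E S" "x \<in> S" "y \<in> S" "z \<in> S"
    and "{x, y} \<in> E" "{x, z} \<in> E" "distinct [x, y, z]"
  obtains w where "S = {x, y, z, w}" "distinct [x, y, z, w]" "{y, w} \<in> E" "{z, w} \<in> E"
proof -
  from assms(1) obtain a b c d where abcd: "distinct [a, b, c, d]" "S = {a, b, c, d}"
    "{a, b} \<in> E" "{b, c} \<in> E" "{c, d} \<in> E" "{d, a} \<in> E" "{a, c} \<notin> E" "{b, d} \<notin> E"
    unfolding chordless_square_def by blast
  \<comment> \<open>The cycle is read as \<open>p, q, r, s\<close>. Only the edges at
    \<open>r\<close> and the missing chord \<open>{p, r}\<close> are kept, so rotating the cycle
    brings \<open>x\<close> to the first place without a case split.\<close>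
  define sq where "sq p q r s \<longleftrightarrow> distinct [p, q, r, s] \<and> S = {p, q, r, s} \<and> {q, r} \<in> E \<and>
    {s, r} \<in> E \<and> {p, r} \<notin> E" for p q r s
  have "sq a b c d" "sq b c d a" "sq c d a b" "sq d a b c"
    unfolding sq_def using abcd by (simp_all add: insert_commute eq_commute)
  then obtain q r s where sq: "sq x q r s"
    using \<open>x \<in> S\<close> abcd(2) by blast
  \<comment> \<open>The missing chord \<open>{x, r}\<close> rules out \<open>r\<close>.\<close>
  then have "y \<in> {q, s}" "z \<in> {q, s}"
    using assms(2-7) unfolding sq_def by auto
  then consider "y = q" "z = s" | "y = s" "z = q" using assms(7) by auto
  then show ?thesis
  proof cases
    case 1
    then show ?thesis using sq unfolding sq_def by (intro that[of r]) auto
  next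
    case 2
    then show ?thesis using sq unfolding sq_def by (intro that[of r]) auto
  qed
qed

text \<open>The existence half of the unique square property, with the fourth vertex made explicit;
  \<open>w\<close> is opposite \<open>x\<close>.\<close>

lemma unique_square_completion:
  assumes "unique_square_property E Q" "{x, y} \<in> E" "{x, z} \<in> E" "distinct [x, y, z]"
    and "({x, y}, {x, z}) \<notin> Q"
  obtains w where "distinct [x, y, z, w]" "{y, w} \<in> E" "{z, w} \<in> E"
    "chordless_square E {x, y, z, w}" "opposite_edges_related E Q {x, y, z, w}"
proof -
  have "adjacent_edges {x, y} {x, z}"
    using assms(4) by (auto simp: adjacent_edges_def doubleton_eq_iff)
  then obtain S where S: "chordless_square E S" "{x, y} \<subseteq> S" "{x, z} \<subseteq> S"
    "opposite_edges_related E Q S"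
    using assms unfolding unique_square_property_def by blast
  from S(2,3) have "x \<in> S" "y \<in> S" "z \<in> S" by auto
  from chordless_square_fourth_vertex[OF S(1) this assms(2-4)]
  obtain w where w: "S = {x, y, z, w}" "distinct [x, y, z, w]" "{y, w} \<in> E" "{z, w} \<in> E" .
  with S show ?thesis by (intro that[of w]) simp_all
qed

lemma unique_square_eq:
  assumes "unique_square_property E Q" "e \<in> E" "f \<in> E" "adjacent_edges e f" "(e, f) \<notin> Q"
    and "chordless_square E S" "e \<subseteq> S" "f \<subseteq> S" "opposite_edges_related E Q S"
    and "chordless_square E T" "e \<subseteq> T" "f \<subseteq> T" "opposite_edges_related E Q T"
  shows "S = T"
  using assms unfolding unique_square_property_def by blast

text \<open>Used for related pairs of the finer relation \<open>Q\<close>: an \<open>R\<close>-class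
  is a union of \<open>Q\<close>-classes.\<close>

lemma quotient_mem_iff:
  assumes "equiv A r" "C \<in> A // r" "(a, b) \<in> r"
  shows "a \<in> C \<longleftrightarrow> b \<in> C"
  using assms by (metis in_quotient_imp_closed equiv_def symD)

text \<open>One inequality per oriented edge suffices, because traversing the edge backwards gives
  the other.\<close>

lemma card_class_neighbours_le:
  assumes "finite V" "simple_graph V E" "equiv E R" "equiv E Q" "Q \<subseteq> R"
    and usp: "unique_square_property E Q"
    and phi: "\<phi> \<in> E // R" and edge: "{x, x'} \<in> E - \<phi>"
  shows "card (neighbours \<phi> x \<inter> component V (E - \<phi>) b)
    \<le> card (neighbours \<phi> x' \<inter> component V (E - \<phi>) b)"
proof -
  let ?N = "\<lambda>u. neighbours \<phi> u \<inter> component V (E - \<phi>) b"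
  have phiE: "\<phi> \<subseteq> E" using in_quotient_imp_subset[OF \<open>equiv E R\<close> phi] .
  have transfer: "e \<in> \<phi> \<longleftrightarrow> f \<in> \<phi>" if "(e, f) \<in> Q" for e f
    using quotient_mem_iff[OF \<open>equiv E R\<close> phi] that \<open>Q \<subseteq> R\<close> by blast
  define P where "P z w \<longleftrightarrow> distinct [x, z, x', w] \<and> {z, w} \<in> E \<and> {x', w} \<in> E \<and>
    chordless_square E {x, z, x', w} \<and> opposite_edges_related E Q {x, z, x', w}" for z w
  have ex: "\<exists>w. P z w" if "{x, z} \<in> \<phi>" for z
  proof -
    \<comment> \<open>One edge lies in \<open>\<phi>\<close>, the other does not, so
      \<open>Q\<close> separates them and the square exists.\<close>
    have "({x, z}, {x, x'}) \<notin> Q" using transfer that edge by blast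
    moreover have "distinct [x, z, x']"
      using that edge phiE simple_graph_edgeD(3)[OF assms(2), of x z]
        simple_graph_edgeD(3)[OF assms(2), of x x'] by auto
    ultimately show ?thesis
      using unique_square_completion[OF usp, of x z x'] that edge phiE unfolding P_def by blast
  qed
  have P_phi: "{x', w} \<in> \<phi>" and P_not_phi: "{z, w} \<in> E - \<phi>" if "{x, z} \<in> \<phi>" "P z w" for z w
  proof -
    have "{x, z} \<in> E" "{x, x'} \<in> E" using that phiE edge by auto
    \<comment> \<open>On the cycle \<open>x, z, w, x'\<close> these are the two pairs of opposite
      edges.\<close>
    then have "({x, z}, {x', w}) \<in> Q" "({x, x'}, {z, w}) \<in> Q"
      using \<open>P z w\<close> unfolding P_def opposite_edges_related_def by auto
    then show "{x', w} \<in> \<phi>" "{z, w} \<in> E - \<phi>"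
      using transfer that edge unfolding P_def by blast+
  qed
  have P_inj: "z1 = z2" if "{x, z1} \<in> \<phi>" "P z1 w" "P z2 w" for z1 z2 w
  proof -
    \<comment> \<open>Uniqueness is applied at the corner \<open>x'\<close>: the edges to
      \<open>x\<close> and \<open>w\<close> again lie in distinct \<open>Q\<close>-classes, so they
      determine the vertex set of the square and hence \<open>z\<close>.\<close>
    have "({x', x}, {x', w}) \<notin> Q"
      using transfer P_phi[OF that(1,2)] edge by (auto simp: insert_commute)
    moreover have "adjacent_edges {x', x} {x', w}"
      using that unfolding P_def adjacent_edges_def by (auto simp: doubleton_eq_iff)
    moreover have "{x', x} \<in> E" "{x', w} \<in> E"
      using edge that unfolding P_def by (auto simp: insert_commute)
    ultimately have "{x, z1, x', w} = {x, z2, x', w}"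
      using that unfolding P_def by (intro unique_square_eq[OF usp, of "{x', x}" "{x', w}"]) auto
    then show ?thesis using that unfolding P_def by auto
  qed
  define f where "f z = (SOME w. P z w)" for z
  have f: "P z (f z)" if "{x, z} \<in> \<phi>" for z
    unfolding f_def using ex[OF that] by (rule someI_ex)
  show ?thesis
  proof (rule card_inj_on_le[of f])
    show "inj_on f (?N x)"
    proof (rule inj_onI)
      fix z1 z2 assume "z1 \<in> ?N x" "z2 \<in> ?N x" "f z1 = f z2"
      then show "z1 = z2" using P_inj f unfolding neighbours_def by (metis IntD1 mem_Collect_eq)
    qed
    show "f ` ?N x \<subseteq> ?N x'"
    proof
      fix w assume "w \<in> f ` ?N x"
      then obtain z where z: "w = f z" "{x, z} \<in> \<phi>" "z \<in> component V (E - \<phi>) b"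
        by (auto simp: neighbours_def)
      have edges: "{x', w} \<in> \<phi>" "{z, w} \<in> E - \<phi>"
        using P_phi P_not_phi f z by auto
      have w: "w \<in> V" using edges simple_graph_edgeD[OF assms(2), of z w] by auto
      \<comment> \<open>The edge \<open>{z, w}\<close> avoids \<open>\<phi>\<close>, so
        \<open>w\<close> stays in the component of \<open>z\<close>.\<close>
      have "component V (E - \<phi>) w = component V (E - \<phi>) b"
        using component_edge[OF edges(2) w] component_eq[OF z(3)] by simp
      then show "w \<in> ?N x'"
        using edges(1) component_self[OF w] by (auto simp: neighbours_def)
    qed
    show "finite (?N x')" using \<open>finite V\<close> by (auto simp: component_def)
  qed
qed

lemma card_class_neighbours_component:
  assumes "finite V" "simple_graph V E" "equiv E R" "equiv E Q" "Q \<subseteq> R"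
    and "unique_square_property E Q" "\<phi> \<in> E // R" "y \<in> component V (E - \<phi>) x"
  shows "card (neighbours \<phi> x \<inter> component V (E - \<phi>) b)
    = card (neighbours \<phi> y \<inter> component V (E - \<phi>) b)"
proof -
  have "(x, y) \<in> {(u, v). {u, v} \<in> E - \<phi>}\<^sup>*"
    using assms(8) by (simp add: component_def)
  then show ?thesis
  proof (induction rule: rtrancl_induct)
    case (step u v)
    then have "{u, v} \<in> E - \<phi>" "{v, u} \<in> E - \<phi>" by (auto simp: insert_commute)
    then show ?case
      using step.IH card_class_neighbours_le[OF assms(1-7)] by (metis order_antisym)
  qed simp
qed

text \<open>An edge \<open>{x, z}\<close> in \<open>\<phi>\<close> survives the removal of any other
  class \<open>\<psi>\<close>, so \<open>z\<close> inherits the \<open>\<psi>\<close>-component of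
  \<open>x\<close>. Only the condition for \<open>\<phi>\<close> itself still depends on
  \<open>z\<close>.\<close>

lemma class_neighbours_V_class:
  assumes "simple_graph V E" "equiv E R" "\<phi> \<in> E // R"
  shows "neighbours \<phi> x \<inter> V_class V E R b =
    (if \<forall>\<psi>\<in>E // R - {\<phi>}. component V (E - \<psi>) x = component V (E - \<psi>) b
     then neighbours \<phi> x \<inter> component V (E - \<phi>) b else {})"
proof -
  have comp: "z \<in> V \<and> component V (E - \<psi>) z = component V (E - \<psi>) x"
    if "z \<in> neighbours \<phi> x" "\<psi> \<in> E // R - {\<phi>}" for z \<psi>
  proof -
    have "{x, z} \<in> \<phi>" using that by (simp add: neighbours_def)
    moreover have "\<phi> \<subseteq> E" using in_quotient_imp_subset[OF assms(2,3)] .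
    moreover have "\<phi> \<inter> \<psi> = {}" using quotient_disj[OF assms(2,3)] that by blast
    ultimately have xz: "{x, z} \<in> E - \<psi>" by blast
    then have z: "z \<in> V" using simple_graph_edgeD(2)[OF assms(1)] by blast
    with component_edge[OF xz z] show ?thesis by simp
  qed
  have "z \<in> V_class V E R b \<longleftrightarrow> z \<in> component V (E - \<phi>) b \<and>
      (\<forall>\<psi>\<in>E // R - {\<phi>}. component V (E - \<psi>) x = component V (E - \<psi>) b)"
    if "z \<in> neighbours \<phi> x" for z
  proof -
    have "E // R = insert \<phi> (E // R - {\<phi>})" using assms(3) by blast
    then have "z \<in> V_class V E R b \<longleftrightarrow> z \<in> component V (E - \<phi>) b \<and>
        (\<forall>\<psi>\<in>E // R - {\<phi>}. component V (E - \<psi>) z = component V (E - \<psi>) b)"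
      unfolding V_class_iff component_eq_iff[of z] by (metis insert_iff)
    then show ?thesis using comp[OF that] by simp
  qed
  then show ?thesis by auto
qed

text \<open>The classes partition \<open>E\<close>, so each neighbour \<open>z\<close> is counted
  once, under the class of \<open>{x, z}\<close>.\<close>

lemma card_neighbours_eq_sum_classes:
  assumes "finite V" "simple_graph V E" "equiv E R"
  shows "card (neighbours E x \<inter> B) = (\<Sum>\<phi>\<in>E // R. card (neighbours \<phi> x \<inter> B))"
proof -
  have nV: "neighbours E x \<subseteq> V"
    using simple_graph_edgeD[OF assms(2)] by (auto simp: neighbours_def)
  have split: "neighbours E x \<inter> B = (\<Union>\<phi>\<in>E // R. neighbours \<phi> x \<inter> B)"
    using Union_quotient[OF assms(3)] by (auto simp: neighbours_def)
  have "finite (E // R)"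
    using finite_quotient finite_edges[OF assms(1,2)] assms(3) equiv_type by blast
  moreover have "finite (neighbours \<phi> x \<inter> B)" if "\<phi> \<in> E // R" for \<phi>
    by (rule finite_subset[of _ V]) (use split nV that assms(1) in blast)+
  moreover have "(neighbours \<phi> x \<inter> B) \<inter> (neighbours \<psi> x \<inter> B) = {}"
    if "\<phi> \<in> E // R" "\<psi> \<in> E // R" "\<phi> \<noteq> \<psi>" for \<phi> \<psi>
    using quotient_disj[OF assms(3) that(1,2)] that(3) by (auto simp: neighbours_def)
  ultimately show ?thesis
    unfolding split by (intro card_UN_disjoint) auto
qed

theorem mainTheorem1:
  fixes V :: "'a set" and E :: "'a set set" and R :: "'a set rel"
  assumes "finite V" and "simple_graph V E" and "connected_graph V E"
    and "USP_relation E R"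
  shows "equitable_partition V E (vertex_partition V E R)"
proof -
  from \<open>USP_relation E R\<close> obtain Q where R: "equiv E R"
    and Q: "equiv E Q" "Q \<subseteq> R" "unique_square_property E Q"
    unfolding USP_relation_def by blast
  have "card (neighbours E x \<inter> B) = card (neighbours E y \<inter> B)"
    if AB: "A \<in> vertex_partition V E R" "B \<in> vertex_partition V E R" and "x \<in> A" "y \<in> A" for A B x y
  proof -
    obtain a b where A: "A = V_class V E R a" and B: "B = V_class V E R b"
      using AB unfolding vertex_partition_def by blast
    have y: "y \<in> V"
      using \<open>y \<in> A\<close> unfolding A V_class_iff by blast
    have comp: "component V (E - \<psi>) y = component V (E - \<psi>) x" if "\<psi> \<in> E // R" for \<psi>
      using \<open>x \<in> A\<close> \<open>y \<in> A\<close> that unfolding A V_class_iff by simp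
    have "card (neighbours \<phi> x \<inter> B) = card (neighbours \<phi> y \<inter> B)" if phi: "\<phi> \<in> E // R" for \<phi>
    proof -
      have "y \<in> component V (E - \<phi>) x"
        using component_self y comp phi by metis
      \<comment> \<open>By \<open>comp\<close>, the case distinction on the other classes comes out
        the same for \<open>x\<close> and \<open>y\<close>; in the nonempty case the counts agree
        because \<open>x\<close> and \<open>y\<close> share a component without
        \<open>\<phi>\<close>.\<close>
      from card_class_neighbours_component[OF assms(1,2) R Q phi this]
      show ?thesis
        unfolding B class_neighbours_V_class[OF assms(2) R phi] using comp by simp
    qed
    then show ?thesis
      unfolding card_neighbours_eq_sum_classes[OF assms(1,2) R] by (rule sum.cong[OF refl])
  qed
  then show ?thesis
    unfolding equitable_partition_def using partition_on_vertex_partition by blast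
qed

end
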